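(* Let $f,c,g$ satisfy the standing assumptions, let $\mu\in(0,\gamma_g)$ and $\hat y\in\mathbb{R}^m$ be fixed, let $F,P,p,\mathbf{O}$ be as in the context, and assume $\inf p\in\mathbb{R}$. Consider a sequence of iterates $\{x^j\}_{j\in\mathbb{N}}$ generated by the nonmonotone descent method with an oracle (described in the context) with $\varepsilon=0$. Let $x^\ast\in\mathbb{R}^n$ be an accumulation point of $\{x^j\}_{j\in\mathbb{N}}$. Then $x^\ast$ is $\Upsilon$-stationary for $p$, namely there exists $z^\ast\in\mathbf{O}(x^\ast)$ such that $\nabla_xF(x^\ast,z^\ast)=0$.
   Context: Write $\overline{\mathbb{R}}=\mathbb{R}\cup\{\infty\}$. Standing assumptions: $f:\mathbb{R}^n\to\mathbb{R}$ and $c:\mathbb{R}^n\to\mathbb{R}^m$ are continuously differentiable; $g:\mathbb{R}^m\to\overline{\mathbb{R}}$ is proper, lower semicontinuous and prox-bounded (i.e. $g+\|\cdot\|^2/(2\gamma)$ is bounded below for some $\gamma>0$; the supremum of such $\gamma$ is the threshold $\gamma_g\in(0,\infty]$); $\inf_x\{f(x)+g(c(x))\}\in\mathbb{R}$. For fixed $\mu\in(0,\gamma_g)$ and $\hat y\in\mathbb{R}^m$ define $F(x,z):=f(x)+\frac1{2\mu}\|c(x)+\mu\hat y-z\|^2$, $\ P(x,z):=F(x,z)+g(z)$, $\ p(x):=\inf_{z\in\mathbb{R}^m}P(x,z)$, $\ \mathbf{O}(x):=\operatorname{argmin}_{z\in\mathbb{R}^m}P(x,z)$. $\Upsilon$-stationarity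 of $x^\ast$ for $p$ means $0\in\Upsilon(x^\ast):=\bigcup_{z\in\mathbf{O}(x^\ast)}\{v:(v,0)\in\partial P(x^\ast,z)\}$, with $\partial$ the limiting (Mordukhovich) subdifferential. Nonmonotone descent method with an oracle: given $x^0\in\mathbb{R}^n$ and $\varepsilon\ge0$, select parameters $\alpha,\beta,\theta\in(0,1)$, $\omega,\nu\in(0,1]$ and set $\Phi_0:=p(x^0)$. For $j=0,1,2,\dots$: (1) select any $z^j\in\mathbf{O}(x^j)$ and set $\nabla p^j:=\nabla_xF(x^j,z^j)$; (2) if $\|\nabla p^j\|\le\varepsilon$, stop and return $(x^\ast,z^\ast):=(x^j,z^j)$; (3) compute any $d^j\in\mathbb{R}^n$ with $\langle\nabla p^j,d^j\rangle\le-\theta\|\nabla p^j\|\|d^j\|$ and $\|d^j\|\ge\omega\|\nabla p^j\|$; (4) compute (by backtracking over $\ell_j=0,1,2,\dots$) the largest $\gamma_j=\beta^{\ell_j}$, $\ell_j\in\mathbb{N}$, and a point $x^{j+1}\in\mathbb{R}^n$ such that $p(x^{j+1})\le p(x^j+\gamma_jd^j)\le\Phi_j+\alpha\gamma_j\langle\nabla p^j,d^j\rangle$; (5) set $\Phi_{j+1}:=(1-\nu)\Phi_j+\nu\,p(x^{j+1})$. *)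

theory Defs
  imports "HOL-Analysis.Analysis"
begin

definition continuously_differentiable ::
  "('a::real_normed_vector \<Rightarrow> 'b::real_normed_vector) \<Rightarrow> bool" where
  "continuously_differentiable h \<longleftrightarrow>
     (\<exists>h' :: 'a \<Rightarrow> ('a \<Rightarrow>\<^sub>L 'b).
        (\<forall>x. (h has_derivative blinfun_apply (h' x)) (at x)) \<and> continuous_on UNIV h')"

text \<open>Functions with values in the reals extended by \<open>\<infinity>\<close> are modelled as \<open>ereal\<close>-valued
  functions; properness is what excludes the value \<open>-\<infinity>\<close>.\<close>

definition proper_fun :: "('a \<Rightarrow> ereal) \<Rightarrow> bool" where
  "proper_fun g \<longleftrightarrow> (\<forall>z. g z \<noteq> -\<infinity>) \<and> (\<exists>z. g z \<noteq> \<infinity>)"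

definition lower_semicontinuous :: "('a::topological_space \<Rightarrow> ereal) \<Rightarrow> bool" where
  "lower_semicontinuous g \<longleftrightarrow> (\<forall>z. g z \<le> Liminf (at z) g)"

definition prox_bounded_with :: "('a::real_normed_vector \<Rightarrow> ereal) \<Rightarrow> real \<Rightarrow> bool" where
  "prox_bounded_with g \<gamma> \<longleftrightarrow>
     \<gamma> > 0 \<and> (\<exists>b::real. \<forall>z. ereal b \<le> g z + ereal ((norm z)\<^sup>2 / (2 * \<gamma>)))"

definition prox_bounded :: "('a::real_normed_vector \<Rightarrow> ereal) \<Rightarrow> bool" where
  "prox_bounded g \<longleftrightarrow> (\<exists>\<gamma>. prox_bounded_with g \<gamma>)"

definition prox_threshold :: "('a::real_normed_vector \<Rightarrow> ereal) \<Rightarrow> ereal" where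
  "prox_threshold g = (SUP \<gamma>\<in>{\<gamma>. prox_bounded_with g \<gamma>}. ereal \<gamma>)"

text \<open>Regular (Frechet) and limiting (Mordukhovich) subdifferentials; both are empty outside the
  effective domain.\<close>

definition regular_subdiff :: "('a::real_inner \<Rightarrow> ereal) \<Rightarrow> 'a \<Rightarrow> 'a set" where
  "regular_subdiff h x =
     {v. \<bar>h x\<bar> \<noteq> \<infinity> \<and>
         0 \<le> Liminf (at x) (\<lambda>y. (h y - h x - ereal (v \<bullet> (y - x))) / ereal (norm (y - x)))}"

definition limiting_subdiff :: "('a::real_inner \<Rightarrow> ereal) \<Rightarrow> 'a \<Rightarrow> 'a set" where
  "limiting_subdiff h x =
     {v. \<bar>h x\<bar> \<noteq> \<infinity> \<and>
         (\<exists>xs vs. xs \<longlonglongrightarrow> x \<and> (\<lambda>k. h (xs k)) \<longlonglongrightarrow> h x \<and>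
                  (\<forall>k. vs k \<in> regular_subdiff h (xs k)) \<and> vs \<longlonglongrightarrow> v)}"

definition F_fun ::
  "('a::real_normed_vector \<Rightarrow> real) \<Rightarrow> ('a \<Rightarrow> 'b::real_normed_vector) \<Rightarrow> real \<Rightarrow> 'b \<Rightarrow> 'a \<Rightarrow> 'b \<Rightarrow> real"
  where
  "F_fun f c \<mu> y x z = f x + 1 / (2 * \<mu>) * (norm (c x + \<mu> *\<^sub>R y - z))\<^sup>2"

definition P_fun ::
  "('a::real_normed_vector \<Rightarrow> real) \<Rightarrow> ('a \<Rightarrow> 'b::real_normed_vector) \<Rightarrow> ('b \<Rightarrow> ereal) \<Rightarrow>
   real \<Rightarrow> 'b \<Rightarrow> 'a \<Rightarrow> 'b \<Rightarrow> ereal" where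
  "P_fun f c g \<mu> y x z = ereal (F_fun f c \<mu> y x z) + g z"

definition p_fun ::
  "('a::real_normed_vector \<Rightarrow> real) \<Rightarrow> ('a \<Rightarrow> 'b::real_normed_vector) \<Rightarrow> ('b \<Rightarrow> ereal) \<Rightarrow>
   real \<Rightarrow> 'b \<Rightarrow> 'a \<Rightarrow> ereal" where
  "p_fun f c g \<mu> y x = (INF z. P_fun f c g \<mu> y x z)"

definition oracle_set ::
  "('a::real_normed_vector \<Rightarrow> real) \<Rightarrow> ('a \<Rightarrow> 'b::real_normed_vector) \<Rightarrow> ('b \<Rightarrow> ereal) \<Rightarrow>
   real \<Rightarrow> 'b \<Rightarrow> 'a \<Rightarrow> 'b set" where
  "oracle_set f c g \<mu> y x = {z. is_arg_min (P_fun f c g \<mu> y x) (\<lambda>_. True) z}"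

definition Upsilon ::
  "('a::real_inner \<Rightarrow> real) \<Rightarrow> ('a \<Rightarrow> 'b::real_inner) \<Rightarrow> ('b \<Rightarrow> ereal) \<Rightarrow>
   real \<Rightarrow> 'b \<Rightarrow> 'a \<Rightarrow> 'a set" where
  "Upsilon f c g \<mu> y x =
     (\<Union>z\<in>oracle_set f c g \<mu> y x.
        {v. (v, 0) \<in> limiting_subdiff (\<lambda>(x', z'). P_fun f c g \<mu> y x' z') (x, z)})"

definition Upsilon_stationary ::
  "('a::real_inner \<Rightarrow> real) \<Rightarrow> ('a \<Rightarrow> 'b::real_inner) \<Rightarrow> ('b \<Rightarrow> ereal) \<Rightarrow>
   real \<Rightarrow> 'b \<Rightarrow> 'a \<Rightarrow> bool" where
  "Upsilon_stationary f c g \<mu> y x \<longleftrightarrow> 0 \<in> Upsilon f c g \<mu> y x"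

text \<open>The line search condition on a stepsize \<open>t\<close> and a candidate next iterate \<open>x'\<close>, with
  \<open>\<phi>\<close> the current merit value and \<open>v\<close> the current gradient.\<close>

definition step_acceptable ::
  "('a::real_inner \<Rightarrow> ereal) \<Rightarrow> real \<Rightarrow> ereal \<Rightarrow> 'a \<Rightarrow> 'a \<Rightarrow> 'a \<Rightarrow> real \<Rightarrow> 'a \<Rightarrow> bool" where
  "step_acceptable p \<alpha> \<phi> x v d t x' \<longleftrightarrow>
     p x' \<le> p (x + t *\<^sub>R d) \<and> p (x + t *\<^sub>R d) \<le> \<phi> + ereal (\<alpha> * t * (v \<bullet> d))"

text \<open>An infinite run of the method: \<open>x\<close> are the iterates, \<open>z\<close> the oracle answers, \<open>v\<close> the
  gradients of \<open>F\<close> with respect to the first variable at \<open>(x j, z j)\<close>, \<open>d\<close> the directions,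
  \<open>t\<close> the stepsizes and \<open>\<Phi>\<close> the merit values. Since the sequences are infinite, the
  stopping test fails at every \<open>j\<close>. The merit values are kept in \<open>ereal\<close>, like \<open>p\<close>.\<close>

definition nonmonotone_descent_run ::
  "('a::real_inner \<Rightarrow> real) \<Rightarrow> ('a \<Rightarrow> 'b::real_inner) \<Rightarrow> ('b \<Rightarrow> ereal) \<Rightarrow> real \<Rightarrow> 'b \<Rightarrow>
   real \<Rightarrow> real \<Rightarrow> real \<Rightarrow> real \<Rightarrow> real \<Rightarrow> real \<Rightarrow>
   (nat \<Rightarrow> 'a) \<Rightarrow> (nat \<Rightarrow> 'b) \<Rightarrow> (nat \<Rightarrow> 'a) \<Rightarrow> (nat \<Rightarrow> 'a) \<Rightarrow> (nat \<Rightarrow> real) \<Rightarrow> (nat \<Rightarrow> ereal) \<Rightarrow> bool"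
  where
  "nonmonotone_descent_run f c g \<mu> y \<epsilon> \<alpha> \<beta> \<theta> \<omega> \<nu> x z v d t \<Phi> \<longleftrightarrow>
     (let p = p_fun f c g \<mu> y in
      0 \<le> \<epsilon> \<and> \<alpha> \<in> {0<..<1} \<and> \<beta> \<in> {0<..<1} \<and> \<theta> \<in> {0<..<1} \<and> \<omega> \<in> {0<..1} \<and> \<nu> \<in> {0<..1} \<and>
      \<Phi> 0 = p (x 0) \<and>
      (\<forall>j.
         z j \<in> oracle_set f c g \<mu> y (x j) \<and>
         GDERIV (\<lambda>u. F_fun f c \<mu> y u (z j)) (x j) :> v j \<and>
         \<not> norm (v j) \<le> \<epsilon> \<and>
         v j \<bullet> d j \<le> - \<theta> * norm (v j) * norm (d j) \<and>
         norm (d j) \<ge> \<omega> * norm (v j) \<and>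
         (\<exists>l::nat. t j = \<beta> ^ l) \<and>
         step_acceptable p \<alpha> (\<Phi> j) (x j) (v j) (d j) (t j) (x (Suc j)) \<and>
         (\<forall>l::nat. (\<exists>x'. step_acceptable p \<alpha> (\<Phi> j) (x j) (v j) (d j) (\<beta> ^ l) x') \<longrightarrow> \<beta> ^ l \<le> t j) \<and>
         \<Phi> (Suc j) = ereal (1 - \<nu>) * \<Phi> j + ereal \<nu> * p (x (Suc j))))"

definition accumulation_point :: "(nat \<Rightarrow> 'a::topological_space) \<Rightarrow> 'a \<Rightarrow> bool" where
  "accumulation_point x a \<longleftrightarrow> (\<exists>r. strict_mono r \<and> (x \<circ> r) \<longlonglongrightarrow> a)"

end

theory Submission
  imports Defs
begin

text \<open>
  In \<open>P(x, z) = F(x, z) + g z\<close> the first term is smooth in \<open>x\<close> and the nonsmooth second one depends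
  on \<open>z\<close> alone. An oracle answer \<open>z\<close> at \<open>x\<close> therefore gives a smooth majorant
  \<open>F(-, z) + g z\<close> of \<open>p\<close> that is exact at \<open>x\<close>, and the classical argument for gradient methods
  applies to the majorant although \<open>p\<close> itself need not be differentiable.

  Summing the sufficient decrease over the monotone merit values gives
  \<open>t j * norm (v j) * norm (d j) \<longlonglongrightarrow> 0\<close> (\<open>descent_run_steps_vanish\<close>). Along a subsequence of
  iterates converging to the accumulation point the oracle answers stay bounded, because \<open>\<mu>\<close> is
  below the prox-boundedness threshold (\<open>oracle_answers_bounded\<close>), so a further subsequence of them
  converges, and by lower semicontinuity of \<open>g\<close> its limit is again an oracle answer
  (\<open>oracle_set_closed_graph\<close>). Suppose that the partial derivative of \<open>F\<close> at the limit pair were not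
  zero. Then the gradients \<open>v\<close> are bounded away from zero on the subsequence, hence so are the
  directions, while \<open>t * norm d\<close> tends to zero; so \<open>t\<close> is eventually below 1 and
  the trial step \<open>t / \<beta>\<close> was rejected. Rejection says that \<open>F(-, z)\<close> decreases along \<open>d\<close> by less
  than the fraction \<open>\<alpha>\<close> of the first-order prediction, although the trial points also converge to
  the accumulation point. Since \<open>F(-, z)\<close> is strictly differentiable uniformly in \<open>z\<close>
  (\<open>partial_derivative_strict\<close>), the actual and the predicted decrease differ by an arbitrarily small
  multiple of the step length, which contradicts the angle condition
  (\<open>descent_run_limit_critical\<close>). The directions themselves may be unbounded; what tends to zero
  is the length \<open>t * norm d\<close> of the whole step.

  Finally, a partial minimiser in \<open>z\<close> at which the derivative in \<open>x\<close> vanishes has zero as a regular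
  subgradient of \<open>P\<close>, again by uniform strict differentiability (\<open>Upsilon_stationaryI\<close>).
\<close>

section \<open>The smooth part of the objective\<close>

text \<open>The derivative of \<open>F\<close> in its first variable is kept as a bounded linear functional rather than
  a gradient vector: it is then given by an explicit formula whose continuity is immediate, without
  adjoints of the derivative of \<open>c\<close>.\<close>

definition F_partial ::
  "('a::real_normed_vector \<Rightarrow> 'a \<Rightarrow>\<^sub>L real) \<Rightarrow> ('a \<Rightarrow> 'b::real_inner) \<Rightarrow> ('a \<Rightarrow> 'a \<Rightarrow>\<^sub>L 'b) \<Rightarrow>
   real \<Rightarrow> 'b \<Rightarrow> 'a \<Rightarrow> 'b \<Rightarrow> 'a \<Rightarrow>\<^sub>L real" where
  "F_partial f' c c' \<mu> y x z = f' x + (1 / \<mu>) *\<^sub>R (blinfun_inner_right (c x + \<mu> *\<^sub>R y - z) o\<^sub>L c' x)"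

lemma F_fun_has_derivative:
  fixes c :: "'a::real_normed_vector \<Rightarrow> 'b::real_inner"
  assumes "(f has_derivative blinfun_apply (f' x)) (at x)"
    and "(c has_derivative blinfun_apply (c' x)) (at x)"
    and "0 < \<mu>"
  shows "((\<lambda>u. F_fun f c \<mu> y u z) has_derivative blinfun_apply (F_partial f' c c' \<mu> y x z)) (at x)"
  unfolding F_fun_def power2_norm_eq_inner
  by (rule derivative_eq_intros assms refl)+
     (use assms(3) in \<open>auto simp: F_partial_def fun_eq_iff blinfun.bilinear_simps inner_commute field_simps\<close>)

lemma F_partial_continuous:
  assumes "continuous_on UNIV f'" "continuous_on UNIV c" "continuous_on UNIV c'"
  shows "continuous_on UNIV (\<lambda>(x, z). F_partial f' c c' \<mu> y x z)"
proof -
  have comp: "continuous_on UNIV (\<lambda>q. h (fst q))" if "continuous_on UNIV h" for h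
    using continuous_on_compose2[OF that continuous_on_fst[OF continuous_on_id]] by auto
  show ?thesis
    unfolding F_partial_def split_beta
    by (intro continuous_intros comp assms
        bounded_linear.continuous_on[OF bounded_linear_blinfun_inner_right])
qed

text \<open>Near a fixed pair \<open>(x0, z0)\<close> one linear map serves all base points \<open>x\<close> and all parameters \<open>z\<close>:
  this is the mean value inequality for \<open>F(-, z) - L x0 z0\<close> on a ball, whose derivative is small
  there by joint continuity of \<open>L\<close>. It is used both to compare a trial step with its first-order
  prediction and to bound \<open>P\<close> from below near a limit point.\<close>

lemma partial_derivative_strict:
  fixes F :: "'a::real_normed_vector \<Rightarrow> 'b::real_normed_vector \<Rightarrow> real"
  assumes der: "\<And>x z. ((\<lambda>u. F u z) has_derivative blinfun_apply (L x z)) (at x)"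
    and cont: "continuous_on UNIV (\<lambda>(x, z). L x z)"
    and "0 < \<epsilon>"
  obtains \<delta> where "0 < \<delta>"
    and "\<And>x x' z. dist x x0 < \<delta> \<Longrightarrow> dist x' x0 < \<delta> \<Longrightarrow> dist z z0 < \<delta> \<Longrightarrow>
           \<bar>F x' z - F x z - L x0 z0 (x' - x)\<bar> \<le> \<epsilon> * norm (x' - x)"
proof -
  have "isCont (\<lambda>(x, z). L x z) (x0, z0)"
    using cont by (simp add: continuous_on_eq_continuous_at)
  then obtain \<eta> where "0 < \<eta>"
    and \<eta>: "\<And>q. dist q (x0, z0) < \<eta> \<Longrightarrow> dist (case q of (x, z) \<Rightarrow> L x z) (L x0 z0) < \<epsilon>"
    using \<open>0 < \<epsilon>\<close> unfolding continuous_at_eps_delta by fastforce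
  have close: "norm (L x z - L x0 z0) \<le> \<epsilon>" if "dist x x0 < \<eta> / 2" "dist z z0 < \<eta> / 2" for x z
  proof -
    have "dist (x, z) (x0, z0) \<le> dist x x0 + dist z z0"
      by (simp add: dist_Pair_Pair sqrt_sum_squares_le_sum)
    with that have "dist (x, z) (x0, z0) < \<eta>" by linarith
    from \<eta>[OF this] show ?thesis by (simp add: dist_norm)
  qed
  show thesis
  proof (rule that[of "\<eta> / 2"])
    show "0 < \<eta> / 2" using \<open>0 < \<eta>\<close> by simp
    fix x x' z
    assume x: "dist x x0 < \<eta> / 2" and x': "dist x' x0 < \<eta> / 2" and z: "dist z z0 < \<eta> / 2"
    let ?G = "\<lambda>u. F u z - L x0 z0 u"
    have "norm (?G x' - ?G x) \<le> \<epsilon> * norm (x' - x)"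
    proof (rule differentiable_bound[of "ball x0 (\<eta> / 2)" ?G "\<lambda>u. blinfun_apply (L u z - L x0 z0)"])
      show "convex (ball x0 (\<eta> / 2))" by simp
      show "(?G has_derivative blinfun_apply (L u z - L x0 z0)) (at u within ball x0 (\<eta> / 2))" for u
        by (rule derivative_eq_intros has_derivative_at_withinI[OF der] refl)+
           (simp add: fun_eq_iff blinfun.bilinear_simps)
      show "onorm (blinfun_apply (L u z - L x0 z0)) \<le> \<epsilon>" if "u \<in> ball x0 (\<eta> / 2)" for u
        using close[of u z] that z by (simp add: norm_blinfun.rep_eq dist_commute)
    qed (use x x' in \<open>auto simp: dist_commute\<close>)
    then show "\<bar>F x' z - F x z - L x0 z0 (x' - x)\<bar> \<le> \<epsilon> * norm (x' - x)"
      by (simp add: blinfun.bilinear_simps algebra_simps)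
  qed
qed

lemma norm_blinfun_inner_right: "norm (blinfun_inner_right v) = norm v"
proof (rule norm_blinfun_eqI)
  show "norm v \<le> norm (blinfun_inner_right v v) / norm v"
    by (simp add: dot_square_norm power2_eq_square)
  show "norm (blinfun_inner_right v h) \<le> norm v * norm h" for h
    using Cauchy_Schwarz_ineq2[of v h] by simp
qed simp

lemma gderiv_eq_blinfun:
  assumes "GDERIV h x :> v" and "(h has_derivative blinfun_apply l) (at x)"
  shows "l = blinfun_inner_right v"
  using has_derivative_unique[OF assms(2) assms(1)[unfolded gderiv_def]]
  by (intro blinfun_eqI) (simp add: inner_commute)

section \<open>The oracle\<close>

lemma oracle_setD:
  assumes "z \<in> oracle_set f c g \<mu> y x"
  shows "P_fun f c g \<mu> y x z \<le> P_fun f c g \<mu> y x w"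
    and "p_fun f c g \<mu> y x = P_fun f c g \<mu> y x z"
proof -
  show le: "P_fun f c g \<mu> y x z \<le> P_fun f c g \<mu> y x w" for w
    using assms by (simp add: oracle_set_def is_arg_min_linorder)
  show "p_fun f c g \<mu> y x = P_fun f c g \<mu> y x z"
    unfolding p_fun_def by (intro antisym INF_lower INF_greatest le) auto
qed

lemma oracle_setI:
  assumes "\<And>w. P_fun f c g \<mu> y x z \<le> P_fun f c g \<mu> y x w"
  shows "z \<in> oracle_set f c g \<mu> y x"
  using assms by (simp add: oracle_set_def is_arg_min_linorder)

lemma oracle_set_finite:
  assumes "proper_fun g" "z \<in> oracle_set f c g \<mu> y x"
  shows "\<bar>g z\<bar> \<noteq> \<infinity>"
proof -
  obtain w where "g w \<noteq> \<infinity>" using assms(1) by (auto simp: proper_fun_def)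
  then have "P_fun f c g \<mu> y x z \<noteq> \<infinity>"
    using oracle_setD(1)[OF assms(2), of w] by (auto simp: P_fun_def)
  then show ?thesis using assms(1) by (auto simp: P_fun_def proper_fun_def)
qed

lemma quadratic_bound:
  fixes r :: real
  assumes "0 < \<delta>" "0 \<le> r" "\<delta> * r\<^sup>2 \<le> C + B * r"
  shows "r \<le> max 1 ((\<bar>C\<bar> + B) / \<delta>)"
proof (cases "r \<le> 1")
  case False
  then have "C + B * r \<le> (\<bar>C\<bar> + B) * r"
    using mult_left_mono[of 1 r "\<bar>C\<bar>"] by (simp add: algebra_simps)
  with assms(3) have "(\<delta> * r) * r \<le> (\<bar>C\<bar> + B) * r" by (simp add: power2_eq_square algebra_simps)
  then have "\<delta> * r \<le> \<bar>C\<bar> + B" using False by simp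
  then show ?thesis using assms(1) by (simp add: field_simps le_max_iff_disj)
qed auto

text \<open>An oracle answer \<open>z\<close> does at least as well as one fixed point \<open>w\<close> of the domain of \<open>g\<close>. The
  threshold supplies some \<open>\<gamma> > \<mu>\<close> with \<open>g\<close> bounded below by a constant minus
  \<open>(norm z)\<^sup>2 / (2 * \<gamma>)\<close>, so the penalty, with its larger coefficient \<open>1 / (2 * \<mu>)\<close>, makes the
  objective grow quadratically in \<open>z\<close>, uniformly while \<open>c\<close> stays bounded; the value of \<open>f\<close>
  cancels in the comparison.\<close>

lemma oracle_answers_bounded:
  fixes g :: "'b::real_inner \<Rightarrow> ereal"
  assumes g: "proper_fun g" and \<mu>: "0 < \<mu>" "ereal \<mu> < prox_threshold g"
    and bdd: "bounded (range (\<lambda>k. c (x k)))"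
    and z: "\<And>k. z k \<in> oracle_set f c g \<mu> y (x k)"
  shows "bounded (range z)"
proof -
  obtain \<gamma> b where "\<mu> < \<gamma>" and b: "\<And>w. ereal b \<le> g w + ereal ((norm w)\<^sup>2 / (2 * \<gamma>))"
    using \<mu>(2) by (auto simp: prox_threshold_def less_SUP_iff prox_bounded_with_def)
  obtain w G where w: "g w = ereal G" using g
    by (auto simp: proper_fun_def) (metis ereal_cases)
  obtain W where W: "\<And>k. norm (c (x k) + \<mu> *\<^sub>R y) \<le> W"
  proof -
    from bdd obtain B where B: "\<And>k. norm (c (x k)) \<le> B" by (auto simp: bounded_iff)
    have "norm (c (x k) + \<mu> *\<^sub>R y) \<le> B + norm (\<mu> *\<^sub>R y)" for k
      using norm_triangle_ineq[of "c (x k)" "\<mu> *\<^sub>R y"] B[of k] by linarith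
    then show thesis using that by blast
  qed
  define a where "a = 1 / (2 * \<mu>)"
  define e where "e = 1 / (2 * \<gamma>)"
  have "0 < a" "e < a" using \<mu> \<open>\<mu> < \<gamma>\<close> by (auto simp: a_def e_def field_simps)
  have "norm (z k) \<le> max 1 ((\<bar>a * (W + norm w)\<^sup>2 + G - b\<bar> + 2 * a * W) / (a - e))" for k
  proof (rule quadratic_bound)
    let ?s = "c (x k) + \<mu> *\<^sub>R y"
    have "\<bar>g (z k)\<bar> \<noteq> \<infinity>" by (rule oracle_set_finite[OF g z])
    then obtain H where H: "g (z k) = ereal H" by auto
    have "a * (norm (?s - z k))\<^sup>2 + H \<le> a * (norm (?s - w))\<^sup>2 + G"
      using oracle_setD(1)[OF z, of k w] by (simp add: P_fun_def F_fun_def H w a_def)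
    moreover have "b \<le> H + e * (norm (z k))\<^sup>2"
      using b[of "z k"] by (simp add: H e_def)
    moreover have "a * (norm (?s - w))\<^sup>2 \<le> a * (W + norm w)\<^sup>2"
      using norm_triangle_ineq4[of ?s w] W[of k] \<open>0 < a\<close>
      by (intro mult_left_mono power_mono) auto
    moreover have "a * ((norm (z k))\<^sup>2 - 2 * W * norm (z k)) \<le> a * (norm (?s - z k))\<^sup>2"
    proof (rule mult_left_mono)
      have "?s \<bullet> z k \<le> W * norm (z k)"
        using norm_cauchy_schwarz[of ?s "z k"] mult_right_mono[OF W[of k], of "norm (z k)"] by simp
      moreover have "(norm (?s - z k))\<^sup>2 = (norm ?s)\<^sup>2 - 2 * (?s \<bullet> z k) + (norm (z k))\<^sup>2"
        unfolding power2_norm_eq_inner by (simp add: inner_diff_left inner_diff_right inner_commute)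
      ultimately show "(norm (z k))\<^sup>2 - 2 * W * norm (z k) \<le> (norm (?s - z k))\<^sup>2"
        using zero_le_power2[of "norm ?s"] by linarith
    qed (use \<open>0 < a\<close> in simp)
    ultimately show "(a - e) * (norm (z k))\<^sup>2
        \<le> (a * (W + norm w)\<^sup>2 + G - b) + (2 * a * W) * norm (z k)"
      by (simp add: algebra_simps)
  qed (use \<open>e < a\<close> in auto)
  then show ?thesis by (auto simp: bounded_iff)
qed

lemma lower_semicontinuous_seq:
  assumes "lower_semicontinuous g" "z \<longlonglongrightarrow> l" "a < g l"
  shows "\<forall>\<^sub>F k in sequentially. a < g (z k)"
proof -
  have "a < Liminf (at l) g"
    using assms(1,3) unfolding lower_semicontinuous_def by (meson less_le_trans)
  then have "\<forall>\<^sub>F w in at l. a < g w" by (rule less_LiminfD)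
  then have "\<forall>\<^sub>F w in nhds l. a < g w"
    using assms(3) by (auto simp: eventually_at_filter elim!: eventually_mono)
  then show ?thesis using assms(2) by (rule eventually_compose_filterlim)
qed

text \<open>Optimality of \<open>z k\<close> against a competitor \<open>w\<close> bounds \<open>g (z k)\<close> above by
  \<open>F(x k, w) + g w - F(x k, z k)\<close>, which converges; lower semicontinuity passes this bound to
  \<open>g zs\<close>.\<close>

lemma oracle_set_closed_graph:
  fixes g :: "'b::real_inner \<Rightarrow> ereal"
  assumes g: "proper_fun g" "lower_semicontinuous g"
    and cont: "isCont f xs" "isCont c xs"
    and lim: "x \<longlonglongrightarrow> xs" "z \<longlonglongrightarrow> zs"
    and z: "\<And>k. z k \<in> oracle_set f c g \<mu> y (x k)"
  shows "zs \<in> oracle_set f c g \<mu> y xs"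
proof (rule oracle_setI)
  let ?F = "F_fun f c \<mu> y"
  have F: "(\<lambda>k. ?F (x k) (w k)) \<longlonglongrightarrow> ?F xs w'" if "w \<longlonglongrightarrow> w'" for w w'
    unfolding F_fun_def
    by (intro tendsto_intros isCont_tendsto_compose[OF cont(1)] isCont_tendsto_compose[OF cont(2)] lim that)
  fix w
  show "P_fun f c g \<mu> y xs zs \<le> P_fun f c g \<mu> y xs w"
  proof (cases "g w = \<infinity>")
    case False
    then obtain G where G: "g w = ereal G"
      using g(1) by (auto simp: proper_fun_def) (metis ereal_cases)
    let ?R = "?F xs w + G - ?F xs zs"
    have R: "(\<lambda>k. ?F (x k) w + G - ?F (x k) (z k)) \<longlonglongrightarrow> ?R"
      by (intro tendsto_intros F lim)
    have "g zs \<le> ereal ?R"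
    proof (rule ccontr)
      assume "\<not> g zs \<le> ereal ?R"
      then obtain a where a: "?R < a" "ereal a < g zs"
        using ereal_dense2[of "ereal ?R" "g zs"] by (auto simp: not_le)
      from lower_semicontinuous_seq[OF g(2) lim(2) a(2)] order_tendstoD(2)[OF R a(1)]
      have "\<forall>\<^sub>F k in sequentially. False"
      proof eventually_elim
        case (elim k)
        have "\<bar>g (z k)\<bar> \<noteq> \<infinity>" by (rule oracle_set_finite[OF g(1) z])
        then obtain H where H: "g (z k) = ereal H" by auto
        then show False
          using oracle_setD(1)[OF z, of k w] elim by (simp add: P_fun_def G H)
      qed
      then show False by simp
    qed
    then show ?thesis by (cases "g zs") (auto simp: P_fun_def G)
  qed (simp add: P_fun_def)
qed

section \<open>Stationarity from a vanishing partial derivative\<close>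

lemma regular_subset_limiting_subdiff: "regular_subdiff h x \<subseteq> limiting_subdiff h x"
proof
  fix v assume v: "v \<in> regular_subdiff h x"
  then have "\<bar>h x\<bar> \<noteq> \<infinity>" by (simp add: regular_subdiff_def)
  moreover have "\<exists>xs vs. xs \<longlonglongrightarrow> x \<and> (\<lambda>k. h (xs k)) \<longlonglongrightarrow> h x \<and>
      (\<forall>k. vs k \<in> regular_subdiff h (xs k)) \<and> vs \<longlonglongrightarrow> v"
    using v by (intro exI[of _ "\<lambda>_::nat. x"] exI[of _ "\<lambda>_::nat. v"]) auto
  ultimately show "v \<in> limiting_subdiff h x"
    unfolding limiting_subdiff_def by blast
qed

lemma zero_in_regular_subdiffI:
  fixes h :: "'a::real_inner \<Rightarrow> ereal"
  assumes fin: "h x = ereal H"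
    and low: "\<And>e. 0 < e \<Longrightarrow> \<forall>\<^sub>F y in at x. ereal (H - e * norm (y - x)) \<le> h y"
  shows "0 \<in> regular_subdiff h x"
proof -
  have "\<forall>a<0. \<forall>\<^sub>F y in at x. a < (h y - h x - ereal (0 \<bullet> (y - x))) / ereal (norm (y - x))"
  proof (intro allI impI)
    fix a :: ereal assume "a < 0"
    then obtain a' where a': "a < ereal a'" "a' < 0"
      using ereal_dense2[of a 0] by (auto simp: zero_ereal_def)
    have "\<forall>\<^sub>F y in at x. y \<noteq> x" by (simp add: eventually_at_filter)
    with low[of "- a'"] a'(2)
    have "\<forall>\<^sub>F y in at x. ereal (H - (- a') * norm (y - x)) \<le> h y \<and> y \<noteq> x"
      by (auto intro: eventually_conj)
    then show "\<forall>\<^sub>F y in at x. a < (h y - h x - ereal (0 \<bullet> (y - x))) / ereal (norm (y - x))"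
    proof eventually_elim
      case (elim y)
      then have pos: "0 < norm (y - x)" by simp
      have "ereal a' \<le> (h y - h x - ereal (0 \<bullet> (y - x))) / ereal (norm (y - x))"
        using elim pos by (cases "h y") (auto simp: fin field_simps)
      with a'(1) show ?case by (rule less_le_trans)
    qed
  qed
  then show ?thesis by (simp add: regular_subdiff_def fin le_Liminf_iff)
qed

text \<open>Write \<open>P(x, z) - P(xs, zs)\<close> as \<open>(F(x, z) - F(xs, z)) + (P(xs, z) - P(xs, zs))\<close>. The second
  bracket is nonnegative because \<open>zs\<close> is an oracle answer, and the first is \<open>o(norm (x - xs))\<close>
  uniformly in \<open>z\<close> near \<open>zs\<close>. Thus zero is even a regular subgradient.\<close>

lemma Upsilon_stationaryI:
  fixes f :: "'a::real_inner \<Rightarrow> real" and c :: "'a \<Rightarrow> 'b::real_inner"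
  assumes g: "proper_fun g"
    and zs: "zs \<in> oracle_set f c g \<mu> y xs"
    and der: "\<And>x z. ((\<lambda>u. F_fun f c \<mu> y u z) has_derivative blinfun_apply (L x z)) (at x)"
    and cont: "continuous_on UNIV (\<lambda>(x, z). L x z)"
    and crit: "L xs zs = 0"
  shows "Upsilon_stationary f c g \<mu> y xs"
proof -
  let ?F = "F_fun f c \<mu> y" and ?h = "\<lambda>(x, z). P_fun f c g \<mu> y x z"
  obtain G where G: "g zs = ereal G" using oracle_set_finite[OF g zs] by auto
  have "0 \<in> regular_subdiff ?h (xs, zs)"
  proof (rule zero_in_regular_subdiffI)
    show "?h (xs, zs) = ereal (?F xs zs + G)" by (simp add: P_fun_def G)
    fix e :: real assume "0 < e"
    then obtain \<delta> where "0 < \<delta>" and \<delta>: "\<And>x x' z. dist x xs < \<delta> \<Longrightarrow> dist x' xs < \<delta> \<Longrightarrow>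
        dist z zs < \<delta> \<Longrightarrow> \<bar>?F x' z - ?F x z - L xs zs (x' - x)\<bar> \<le> e * norm (x' - x)"
      by (rule partial_derivative_strict[OF der cont]) blast
    have "ereal (?F xs zs + G - e * norm (q - (xs, zs))) \<le> ?h q" if "dist q (xs, zs) < \<delta>" for q
    proof -
      obtain x z where q: "q = (x, z)" by (cases q)
      have dx: "dist x xs \<le> dist q (xs, zs)" and dz: "dist z zs \<le> dist q (xs, zs)"
        using dist_fst_le[of q "(xs, zs)"] dist_snd_le[of q "(xs, zs)"] by (auto simp: q)
      have "\<bar>?F x z - ?F xs z\<bar> \<le> e * norm (x - xs)"
        using \<delta>[of xs x z] dx dz that \<open>0 < \<delta>\<close> crit by simp
      also have "\<dots> \<le> e * norm (q - (xs, zs))"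
        using dx \<open>0 < e\<close> by (simp add: dist_norm)
      finally have "?F xs z - e * norm (q - (xs, zs)) \<le> ?F x z" by linarith
      then show ?thesis
        using oracle_setD(1)[OF zs, of z] by (cases "g z") (auto simp: P_fun_def G q)
    qed
    then show "\<forall>\<^sub>F q in at (xs, zs). ereal (?F xs zs + G - e * norm (q - (xs, zs))) \<le> ?h q"
      using \<open>0 < \<delta>\<close> unfolding eventually_at by blast
  qed
  then have "(0, 0) \<in> limiting_subdiff ?h (xs, zs)"
    using regular_subset_limiting_subdiff by (auto simp: zero_prod_def)
  then show ?thesis using zs by (auto simp: Upsilon_stationary_def Upsilon_def)
qed

section \<open>Properties of a run of the method\<close>

text \<open>The candidate next iterate in the backtracking test may always be the trial point
  itself, so the maximality of the step size speaks of the trial point alone.\<close>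

lemma descent_runD:
  assumes "nonmonotone_descent_run f c g \<mu> y \<epsilon> \<alpha> \<beta> \<theta> \<omega> \<nu> x z v d t \<Phi>"
  shows "0 \<le> \<epsilon>" "0 < \<alpha>" "\<alpha> < 1" "0 < \<beta>" "\<beta> < 1" "0 < \<theta>" "0 < \<omega>" "0 < \<nu>" "\<nu> \<le> 1"
    and "\<Phi> 0 = p_fun f c g \<mu> y (x 0)"
    and "z j \<in> oracle_set f c g \<mu> y (x j)"
    and "GDERIV (\<lambda>u. F_fun f c \<mu> y u (z j)) (x j) :> v j"
    and "\<epsilon> < norm (v j)"
    and "v j \<bullet> d j \<le> - \<theta> * norm (v j) * norm (d j)"
    and "\<omega> * norm (v j) \<le> norm (d j)"
    and "\<exists>l::nat. t j = \<beta> ^ l"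
    and "p_fun f c g \<mu> y (x (Suc j)) \<le> \<Phi> j + ereal (\<alpha> * t j * (v j \<bullet> d j))"
    and "\<And>l::nat. p_fun f c g \<mu> y (x j + \<beta> ^ l *\<^sub>R d j) \<le> \<Phi> j + ereal (\<alpha> * \<beta> ^ l * (v j \<bullet> d j))
           \<Longrightarrow> \<beta> ^ l \<le> t j"
    and "\<Phi> (Suc j) = ereal (1 - \<nu>) * \<Phi> j + ereal \<nu> * p_fun f c g \<mu> y (x (Suc j))"
  using assms
  unfolding nonmonotone_descent_run_def Let_def step_acceptable_def
  by (auto simp: not_le intro: order_trans)

text \<open>All values along a run are real numbers, since \<open>p\<close> is attained at the oracle answers. The
  merit value dominates the current objective value because it is a convex combination of
  the new objective value with a previous merit value that already dominates it.\<close>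

lemma descent_run_merit:
  assumes g: "proper_fun g"
    and run: "nonmonotone_descent_run f c g \<mu> y \<epsilon> \<alpha> \<beta> \<theta> \<omega> \<nu> x z v d t \<Phi>"
  obtains q \<phi> where "\<And>j. p_fun f c g \<mu> y (x j) = ereal (q j)" and "\<And>j. \<Phi> j = ereal (\<phi> j)"
    and "\<And>j. q j \<le> \<phi> j" and "\<And>j. \<phi> (Suc j) \<le> \<phi> j + \<nu> * \<alpha> * t j * (v j \<bullet> d j)"
proof -
  note D = descent_runD[OF run]
  have "\<exists>r. p_fun f c g \<mu> y (x j) = ereal r" for j
  proof -
    have "\<bar>g (z j)\<bar> \<noteq> \<infinity>" by (rule oracle_set_finite[OF g D(11)])
    then show ?thesis using oracle_setD(2)[OF D(11)[of j]] by (auto simp: P_fun_def)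
  qed
  then obtain q where q: "\<And>j. p_fun f c g \<mu> y (x j) = ereal (q j)" by metis
  have "\<exists>r. \<Phi> j = ereal r" for j
    by (induction j) (auto simp: D(10) D(19) q)
  then obtain \<phi> where \<phi>: "\<And>j. \<Phi> j = ereal (\<phi> j)" by metis
  have rec: "\<phi> (Suc j) = (1 - \<nu>) * \<phi> j + \<nu> * q (Suc j)" for j
    using D(19)[of j] by (simp add: \<phi> q)
  have step: "q (Suc j) \<le> \<phi> j + \<alpha> * t j * (v j \<bullet> d j)" for j
    using D(17)[of j] by (simp add: \<phi> q)
  have t: "0 < t j" for j using D(16)[of j] D(4) by auto
  have neg: "v j \<bullet> d j \<le> 0" for j
  proof -
    have "0 \<le> \<theta> * norm (v j) * norm (d j)" using D(6) by simp
    with D(14)[of j] show ?thesis by linarith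
  qed
  show thesis
  proof (rule that[OF q \<phi>])
    fix j
    show "\<phi> (Suc j) \<le> \<phi> j + \<nu> * \<alpha> * t j * (v j \<bullet> d j)"
      using mult_left_mono[OF step[of j], of \<nu>] D(8) by (simp add: rec algebra_simps)
    show "q j \<le> \<phi> j"
    proof (cases j)
      case 0
      then show ?thesis using D(10) by (simp add: \<phi> q)
    next
      case (Suc i)
      have "\<alpha> * t i * (v i \<bullet> d i) \<le> 0"
        using neg[of i] t[of i] D(2) by (simp add: mult_nonneg_nonpos)
      then have "q (Suc i) \<le> \<phi> i" using step[of i] by linarith
      then have "(1 - \<nu>) * q (Suc i) \<le> (1 - \<nu>) * \<phi> i" using D(9) by (intro mult_left_mono) auto
      then show ?thesis by (simp add: Suc rec algebra_simps)
    qed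
  qed
qed

text \<open>The merit values decrease and are bounded below by \<open>m\<close>, so their successive differences tend to
  zero; by the angle condition the difference is at least \<open>\<nu> * \<alpha> * \<theta>\<close> times the \<open>j\<close>-th term.\<close>

lemma descent_run_steps_vanish:
  assumes g: "proper_fun g"
    and run: "nonmonotone_descent_run f c g \<mu> y \<epsilon> \<alpha> \<beta> \<theta> \<omega> \<nu> x z v d t \<Phi>"
    and low: "\<And>u. ereal m \<le> p_fun f c g \<mu> y u"
  shows "(\<lambda>j. t j * (norm (v j) * norm (d j))) \<longlonglongrightarrow> 0"
proof -
  note D = descent_runD[OF run]
  obtain q \<phi> where q: "\<And>j. p_fun f c g \<mu> y (x j) = ereal (q j)" and "\<And>j. \<Phi> j = ereal (\<phi> j)"
    and q\<phi>: "\<And>j. q j \<le> \<phi> j" and dec: "\<And>j. \<phi> (Suc j) \<le> \<phi> j + \<nu> * \<alpha> * t j * (v j \<bullet> d j)"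
    by (rule descent_run_merit[OF g run]) blast
  define K where "K = \<nu> * \<alpha> * \<theta>"
  have K: "0 < K" using D(2,6,8) by (simp add: K_def)
  have t: "0 < t j" for j using D(16)[of j] D(4) by auto
  have bound: "K * (t j * (norm (v j) * norm (d j))) \<le> \<phi> j - \<phi> (Suc j)" for j
  proof -
    have "\<nu> * \<alpha> * t j * (v j \<bullet> d j) \<le> \<nu> * \<alpha> * t j * (- \<theta> * norm (v j) * norm (d j))"
      using D(2,8) t[of j] by (intro mult_left_mono D(14)) simp
    with dec[of j] show ?thesis by (simp add: K_def algebra_simps)
  qed
  have "decseq \<phi>"
  proof (rule decseq_SucI)
    fix j
    have "0 \<le> K * (t j * (norm (v j) * norm (d j)))" using K t[of j] by simp
    with bound[of j] show "\<phi> (Suc j) \<le> \<phi> j" by linarith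
  qed
  moreover have "m \<le> \<phi> j" for j
    using low[of "x j"] q\<phi>[of j] by (simp add: q)
  ultimately obtain l where l: "\<phi> \<longlonglongrightarrow> l" using decseq_convergent[of \<phi> m] by blast
  then have "(\<lambda>j. (\<phi> j - \<phi> (Suc j)) / K) \<longlonglongrightarrow> (l - l) / K"
    using K by (intro tendsto_intros LIMSEQ_Suc) auto
  then have "(\<lambda>j. (\<phi> j - \<phi> (Suc j)) / K) \<longlonglongrightarrow> 0" by simp
  then show ?thesis
    by (rule tendsto_sandwich[OF _ _ tendsto_const, rotated 2])
       (use bound K t in \<open>auto intro!: always_eventually simp: field_simps less_imp_le\<close>)
qed

text \<open>A step size below 1 was preceded by the rejected trial step \<open>t j / \<beta>\<close>. Rejection bounds \<open>p\<close> at
  the trial point from below; there \<open>p\<close> is at most \<open>P(-, z j)\<close>, while at \<open>x j\<close> it equals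
  \<open>P(x j, z j)\<close>, so \<open>g (z j)\<close> cancels and the bound passes to the smooth \<open>F(-, z j)\<close>.\<close>

lemma descent_run_rejected_step:
  assumes g: "proper_fun g"
    and run: "nonmonotone_descent_run f c g \<mu> y \<epsilon> \<alpha> \<beta> \<theta> \<omega> \<nu> x z v d t \<Phi>"
    and "t j < 1"
  shows "\<alpha> * (t j / \<beta>) * (v j \<bullet> d j)
           < F_fun f c \<mu> y (x j + (t j / \<beta>) *\<^sub>R d j) (z j) - F_fun f c \<mu> y (x j) (z j)"
proof -
  note D = descent_runD[OF run]
  let ?p = "p_fun f c g \<mu> y" and ?s = "t j / \<beta>"
  obtain q \<phi> where q: "\<And>j. ?p (x j) = ereal (q j)" and \<phi>: "\<And>j. \<Phi> j = ereal (\<phi> j)"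
    and q\<phi>: "\<And>j. q j \<le> \<phi> j" and "\<And>j. \<phi> (Suc j) \<le> \<phi> j + \<nu> * \<alpha> * t j * (v j \<bullet> d j)"
    by (rule descent_run_merit[OF g run]) blast
  obtain l where l: "t j = \<beta> ^ l" using D(16) by blast
  with \<open>t j < 1\<close> obtain i where "l = Suc i" by (cases l) auto
  with l D(4) have s: "?s = \<beta> ^ i" by simp
  have "t j < \<beta> ^ i" using l \<open>l = Suc i\<close> D(4,5) by simp
  then have "\<Phi> j + ereal (\<alpha> * ?s * (v j \<bullet> d j)) < ?p (x j + ?s *\<^sub>R d j)"
    using D(18)[where j = j and l = i] unfolding s by (meson not_le)
  also have "\<dots> \<le> P_fun f c g \<mu> y (x j + ?s *\<^sub>R d j) (z j)"
    unfolding p_fun_def by (rule INF_lower) simp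
  finally have *: "ereal (\<phi> j + \<alpha> * ?s * (v j \<bullet> d j)) < P_fun f c g \<mu> y (x j + ?s *\<^sub>R d j) (z j)"
    by (simp add: \<phi>)
  have "\<bar>g (z j)\<bar> \<noteq> \<infinity>" by (rule oracle_set_finite[OF g D(11)])
  then obtain G where G: "g (z j) = ereal G" by auto
  have "q j = F_fun f c \<mu> y (x j) (z j) + G"
    using oracle_setD(2)[OF D(11)[of j]] q[of j] by (simp add: P_fun_def G)
  with * q\<phi>[of j] show ?thesis by (simp add: P_fun_def G)
qed

section \<open>Convergence\<close>

text \<open>The tolerance \<open>e\<close> is chosen so that two errors of relative size \<open>e\<close>, one for the linearisation
  of the trial step and one for replacing the limit derivative by \<open>v\<close>, stay below
  \<open>(1 - \<alpha>) * \<theta> * norm v\<close>. By the angle condition this is a lower bound, per unit of step length,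
  for the gap between the predicted decrease and the fraction \<open>\<alpha>\<close> of it.\<close>

lemma descent_run_limit_critical:
  fixes f :: "'a::real_inner \<Rightarrow> real" and c :: "'a \<Rightarrow> 'b::real_inner"
  assumes g: "proper_fun g"
    and run: "nonmonotone_descent_run f c g \<mu> y \<epsilon> \<alpha> \<beta> \<theta> \<omega> \<nu> x z v d t \<Phi>"
    and m: "\<And>u. ereal m \<le> p_fun f c g \<mu> y u"
    and der: "\<And>x z. ((\<lambda>u. F_fun f c \<mu> y u z) has_derivative blinfun_apply (L x z)) (at x)"
    and Lcont: "continuous_on UNIV (\<lambda>(x, z). L x z)"
    and s: "strict_mono s"
    and xs: "(\<lambda>k. x (s k)) \<longlonglongrightarrow> xstar"
    and zs: "(\<lambda>k. z (s k)) \<longlonglongrightarrow> zs"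
  shows "L xstar zs = 0"
proof -
  note D = descent_runD[OF run]
  let ?F = "F_fun f c \<mu> y"
  have vL: "blinfun_inner_right (v j) = L (x j) (z j)" for j
    by (rule gderiv_eq_blinfun[OF D(12) der, symmetric])
  have "isCont (\<lambda>(u, w). L u w) (xstar, zs)"
    using Lcont by (simp add: continuous_on_eq_continuous_at)
  from isCont_tendsto_compose[OF this tendsto_Pair[OF xs zs]]
  have Llim: "(\<lambda>k. L (x (s k)) (z (s k))) \<longlonglongrightarrow> L xstar zs" by simp
  have norm_v: "norm (v j) = norm (L (x j) (z j))" for j
    unfolding vL[symmetric] by (rule norm_blinfun_inner_right[symmetric])
  have vlim: "(\<lambda>k. norm (v (s k))) \<longlonglongrightarrow> norm (L xstar zs)"
    unfolding norm_v by (intro tendsto_intros Llim)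

  show "L xstar zs = 0"
  proof (rule ccontr)
    assume "L xstar zs \<noteq> 0"
    define a where "a = norm (L xstar zs)"
    have "0 < a" using \<open>L xstar zs \<noteq> 0\<close> by (simp add: a_def)
    define e where "e = (1 - \<alpha>) * \<theta> * a / 4"
    have "0 < e" using \<open>0 < a\<close> D(3,6) by (simp add: e_def)
    obtain \<delta> where "0 < \<delta>" and \<delta>: "\<And>u u' w. dist u xstar < \<delta> \<Longrightarrow> dist u' xstar < \<delta> \<Longrightarrow>
        dist w zs < \<delta> \<Longrightarrow> \<bar>?F u' w - ?F u w - L xstar zs (u' - u)\<bar> \<le> e * norm (u' - u)"
      by (rule partial_derivative_strict[OF der Lcont \<open>0 < e\<close>]) blast
    have v_ev: "\<forall>\<^sub>F k in sequentially. a / 2 < norm (v (s k))"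
      using order_tendstoD(1)[OF vlim, of "a / 2"] \<open>0 < a\<close> by (simp add: a_def)
    have tvd: "(\<lambda>k. t (s k) * (norm (v (s k)) * norm (d (s k)))) \<longlonglongrightarrow> 0"
      using LIMSEQ_subseq_LIMSEQ[OF descent_run_steps_vanish[OF g run m] s] by (simp add: o_def)
    have t: "0 < t j" for j using D(16)[of j] D(4) by auto
    have td: "(\<lambda>k. t (s k) * norm (d (s k))) \<longlonglongrightarrow> 0"
    proof (rule tendsto_sandwich[OF _ _ tendsto_const])
      show "\<forall>\<^sub>F k in sequentially. 0 \<le> t (s k) * norm (d (s k))"
        using t by (simp add: less_imp_le)
      show "\<forall>\<^sub>F k in sequentially. t (s k) * norm (d (s k))
          \<le> 2 / a * (t (s k) * (norm (v (s k)) * norm (d (s k))))"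
        using v_ev
      proof eventually_elim
        case (elim k)
        have "a / 2 * (t (s k) * norm (d (s k))) \<le> norm (v (s k)) * (t (s k) * norm (d (s k)))"
          using elim t[of "s k"] by (intro mult_right_mono) auto
        then show ?case using \<open>0 < a\<close> by (simp add: field_simps)
      qed
      show "(\<lambda>k. 2 / a * (t (s k) * (norm (v (s k)) * norm (d (s k))))) \<longlonglongrightarrow> 0"
        by (rule tendsto_mult_right_zero[OF tvd])
    qed
    \<comment> \<open>Since \<open>norm d \<ge> \<omega> * norm v\<close> is bounded away from zero, \<open>t * norm d \<longlonglongrightarrow> 0\<close> forces \<open>t\<close> below 1.\<close>
    have t_ev: "\<forall>\<^sub>F k in sequentially. t (s k) < 1"
    proof -
      have "0 < \<omega> * (a / 2)" using D(7) \<open>0 < a\<close> by simp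
      from v_ev order_tendstoD(2)[OF td this] show ?thesis
      proof eventually_elim
        case (elim k)
        have "\<omega> * (a / 2) < norm (d (s k))"
          using mult_strict_left_mono[OF elim(1) D(7)] D(15)[of "s k"] by linarith
        with elim(2) show ?case
          using mult_right_mono[of 1 "t (s k)" "norm (d (s k))"] by fastforce
      qed
    qed
    have trial: "(\<lambda>k. x (s k) + (t (s k) / \<beta>) *\<^sub>R d (s k)) \<longlonglongrightarrow> xstar"
    proof -
      have "(\<lambda>k. (t (s k) / \<beta>) *\<^sub>R d (s k)) \<longlonglongrightarrow> 0"
      proof (rule tendsto_norm_zero_cancel)
        have "(\<lambda>k. (t (s k) * norm (d (s k))) / \<beta>) \<longlonglongrightarrow> 0 / \<beta>"
          using D(4) by (intro tendsto_divide td) auto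
        then show "(\<lambda>k. norm ((t (s k) / \<beta>) *\<^sub>R d (s k))) \<longlonglongrightarrow> 0"
          using t D(4) by (simp add: less_imp_le)
      qed
      from tendsto_add[OF xs this] show ?thesis by simp
    qed
    from v_ev t_ev tendstoD[OF trial \<open>0 < \<delta>\<close>] tendstoD[OF xs \<open>0 < \<delta>\<close>] tendstoD[OF zs \<open>0 < \<delta>\<close>]
      tendstoD[OF Llim \<open>0 < e\<close>]
    have "\<forall>\<^sub>F k in sequentially. False"
    proof eventually_elim
      case (elim k)
      define \<tau> where "\<tau> = t (s k) / \<beta>"
      let ?d = "d (s k)" and ?v = "v (s k)"
      have "0 < \<tau>" using t[of "s k"] D(4) by (simp add: \<tau>_def)
      have "0 < norm ?d"
        using D(15)[of "s k"] D(13)[of "s k"] D(1) D(7) by (smt (verit) mult_pos_pos)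
      have "\<alpha> * \<tau> * (?v \<bullet> ?d) < ?F (x (s k) + \<tau> *\<^sub>R ?d) (z (s k)) - ?F (x (s k)) (z (s k))"
        unfolding \<tau>_def by (rule descent_run_rejected_step[OF g run elim(2)])
      also have "\<dots> \<le> L xstar zs (\<tau> *\<^sub>R ?d) + e * (\<tau> * norm ?d)"
        using \<delta>[OF elim(4) elim(3) elim(5)] \<open>0 < \<tau>\<close> by (simp add: \<tau>_def[symmetric])
      also have "L xstar zs (\<tau> *\<^sub>R ?d) = \<tau> * (L xstar zs ?d)" by (simp add: blinfun.scaleR_right)
      finally have "\<tau> * (\<alpha> * (?v \<bullet> ?d)) < \<tau> * (L xstar zs ?d + e * norm ?d)"
        by (simp add: algebra_simps)
      then have "\<alpha> * (?v \<bullet> ?d) < L xstar zs ?d + e * norm ?d"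
        using \<open>0 < \<tau>\<close> by simp
      also have "L xstar zs ?d \<le> ?v \<bullet> ?d + e * norm ?d"
      proof -
        have "L xstar zs ?d - ?v \<bullet> ?d = (L xstar zs - L (x (s k)) (z (s k))) ?d"
          unfolding vL[symmetric] by (simp add: blinfun.diff_left)
        also have "\<dots> \<le> norm (L xstar zs - L (x (s k)) (z (s k))) * norm ?d"
          using norm_blinfun[of "L xstar zs - L (x (s k)) (z (s k))" ?d] by simp
        also have "\<dots> \<le> e * norm ?d"
          using elim(6) by (intro mult_right_mono) (auto simp: dist_norm norm_minus_commute)
        finally show ?thesis by simp
      qed
      finally have "(1 - \<alpha>) * - (?v \<bullet> ?d) < 2 * e * norm ?d" by (simp add: algebra_simps)
      moreover have "(1 - \<alpha>) * (\<theta> * norm ?v * norm ?d) \<le> (1 - \<alpha>) * - (?v \<bullet> ?d)"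
        using D(14)[of "s k"] D(3) by (intro mult_left_mono) auto
      ultimately have "((1 - \<alpha>) * \<theta> * norm ?v) * norm ?d < (2 * e) * norm ?d"
        by (simp add: algebra_simps)
      then have "(1 - \<alpha>) * \<theta> * norm ?v < 2 * e" using \<open>0 < norm ?d\<close> by simp
      moreover have "2 * e < (1 - \<alpha>) * \<theta> * norm ?v"
        using mult_strict_left_mono[OF elim(1), of "(1 - \<alpha>) * \<theta>"] D(3,6) by (simp add: e_def)
      ultimately show False by simp
    qed
    then show False by simp
  qed
qed

theorem theorem4p4:
  fixes f :: "real ^ 'n \<Rightarrow> real"
    and c :: "real ^ 'n \<Rightarrow> real ^ 'm"
    and g :: "real ^ 'm \<Rightarrow> ereal"
    and \<mu> \<alpha> \<beta> \<theta> \<omega> \<nu> :: real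
    and yhat :: "real ^ 'm"
    and x v d :: "nat \<Rightarrow> real ^ 'n"
    and z :: "nat \<Rightarrow> real ^ 'm"
    and t :: "nat \<Rightarrow> real"
    and \<Phi> :: "nat \<Rightarrow> ereal"
    and xstar :: "real ^ 'n"
  assumes "continuously_differentiable f"
    and "continuously_differentiable c"
    and "proper_fun g"
    and "lower_semicontinuous g"
    and "prox_bounded g"
    and "\<bar>INF u. ereal (f u) + g (c u)\<bar> \<noteq> \<infinity>"
    and "0 < \<mu>" and "ereal \<mu> < prox_threshold g"
    and "\<bar>INF u. p_fun f c g \<mu> yhat u\<bar> \<noteq> \<infinity>"
    and "nonmonotone_descent_run f c g \<mu> yhat 0 \<alpha> \<beta> \<theta> \<omega> \<nu> x z v d t \<Phi>"
    and "accumulation_point x xstar"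
  shows "Upsilon_stationary f c g \<mu> yhat xstar \<and>
    (\<exists>zstar \<in> oracle_set f c g \<mu> yhat xstar.
       GDERIV (\<lambda>u. F_fun f c \<mu> yhat u zstar) xstar :> 0)"
proof -
  note g = assms(3) and lsc = assms(4) and \<mu> = assms(7,8) and run = assms(10)
  note D = descent_runD[OF run]
  let ?F = "F_fun f c \<mu> yhat" and ?O = "oracle_set f c g \<mu> yhat"
  obtain f' where f': "\<And>u. (f has_derivative blinfun_apply (f' u)) (at u)" "continuous_on UNIV f'"
    using assms(1) by (auto simp: continuously_differentiable_def)
  obtain c' where c': "\<And>u. (c has_derivative blinfun_apply (c' u)) (at u)" "continuous_on UNIV c'"
    using assms(2) by (auto simp: continuously_differentiable_def)
  have fc: "isCont f u" "isCont c u" for u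
    using f'(1) c'(1) by (auto intro: has_derivative_continuous)
  define L where "L = F_partial f' c c' \<mu> yhat"
  have der: "((\<lambda>u. ?F u w) has_derivative blinfun_apply (L u w)) (at u)" for u w
    unfolding L_def by (intro F_fun_has_derivative f' c' \<mu>)
  have Lcont: "continuous_on UNIV (\<lambda>(u, w). L u w)"
    unfolding L_def
    by (intro F_partial_continuous f' c') (auto intro: continuous_at_imp_continuous_on fc)
  obtain m where m: "\<And>u. ereal m \<le> p_fun f c g \<mu> yhat u"
  proof -
    from assms(9) obtain m where "(INF u. p_fun f c g \<mu> yhat u) = ereal m" by auto
    then show thesis using that[of m] by (metis INF_lower UNIV_I)
  qed

  obtain r where "strict_mono r" and xr: "(x \<circ> r) \<longlonglongrightarrow> xstar"
    using assms(11) by (auto simp: accumulation_point_def)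
  have "bounded (range (z \<circ> r))"
  proof (rule oracle_answers_bounded[OF g \<mu>, where x = "x \<circ> r" and c = c and f = f and y = yhat])
    show "bounded (range (\<lambda>k. c ((x \<circ> r) k)))"
      by (rule convergent_imp_bounded[OF isCont_tendsto_compose[OF fc(2) xr]])
    show "(z \<circ> r) k \<in> ?O ((x \<circ> r) k)" for k using D(11) by simp
  qed
  then obtain zs r' where "strict_mono r'" and "((z \<circ> r) \<circ> r') \<longlonglongrightarrow> zs"
    using bounded_imp_convergent_subsequence by blast
  define s where "s = r \<circ> r'"
  have s: "strict_mono s" using \<open>strict_mono r\<close> \<open>strict_mono r'\<close> by (simp add: s_def strict_mono_o)
  have xs: "(\<lambda>k. x (s k)) \<longlonglongrightarrow> xstar"
    using LIMSEQ_subseq_LIMSEQ[OF xr \<open>strict_mono r'\<close>] by (simp add: s_def o_def)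
  have zs: "(\<lambda>k. z (s k)) \<longlonglongrightarrow> zs"
    using \<open>((z \<circ> r) \<circ> r') \<longlonglongrightarrow> zs\<close> by (simp add: s_def o_def)
  have O: "zs \<in> ?O xstar"
    by (rule oracle_set_closed_graph[OF g lsc fc xs zs]) (rule D(11))

  have crit: "L xstar zs = 0"
    by (rule descent_run_limit_critical[OF g run m der Lcont s xs zs])

  have "Upsilon_stationary f c g \<mu> yhat xstar"
    by (rule Upsilon_stationaryI[OF g O der Lcont crit])
  moreover have "GDERIV (\<lambda>u. ?F u zs) xstar :> 0"
    using der[of zs xstar] by (simp add: gderiv_def crit zero_blinfun.rep_eq)
  ultimately show ?thesis using O by blast
qed

end
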